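(* For $k\ge2$, the zeros of $F_k(t)$ satisfy: (i) If $k$ is even, $F_k(t)$ has simple zeros at $t=-1,0,1$ and no other zeros in $[-1,1]$. If $k$ is odd, $F_k(t)$ has exactly two simple symmetric zeros $\pm a_k$ with $a_k\in(0,1)$, and no other zeros in $[-1,1]$. (ii) $\lim_{k\to\infty}a_k=\frac12$ (over odd $k$). More precisely, $$a_k-\frac12=\frac{1}{\pi 2^{k+1}}-\frac{1}{\pi4^{k+1}}+\frac{4}{\pi6^{k+1}}-\frac{17}{6\pi8^{k+1}}+O\!\left(\frac{1}{10^{k+1}}\right).$$
   Context: $L_j$ is the Legendre polynomial of degree $j$. The linear operator $\mathcal F$ on $\operatorname{span}\{L_1,L_2,\dots\}$ is defined by $\mathcal F(L_1)=\frac13L_2$ and $\mathcal F(L_j)=\frac1{2j+1}(L_{j+1}-L_{j-1})$ for $j\ge2$, extended linearly. $F_k=\mathcal F^{k}(L_1)$ is the $k$-fold iterate applied to $L_1$. *)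

theory Defs
  imports Complex_Main "HOL-Computational_Algebra.Polynomial" "HOL-Library.Landau_Symbols"
begin

text \<open>Legendre polynomials, by Rodrigues' formula:
  \<open>L\<^sub>n = 1 / (2\<^sup>n n!) (d/dt)\<^sup>n (t\<^sup>2 - 1)\<^sup>n\<close>.\<close>

definition legendre :: "nat \<Rightarrow> real poly" where
  "legendre n = smult (1 / (2 ^ n * fact n)) ((pderiv ^^ n) ([:-1, 0, 1:] ^ n))"

lemma degree_legendre [simp]: "degree (legendre n) = n"
proof -
  have "degree ([:-1, 0, 1:] ^ n :: real poly) = 2 * n"
    by (simp add: degree_power_eq)
  thus ?thesis
    by (simp add: legendre_def degree_higher_pderiv)
qed

lemma legendre_nonzero [simp]: "legendre n \<noteq> 0"
proof (cases "n = 0")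
  case True
  thus ?thesis by (simp add: legendre_def)
next
  case False
  thus ?thesis by (metis degree_0 degree_legendre)
qed

lemma inj_legendre: "inj legendre"
  by (metis degree_legendre injI)

global_interpretation poly_vs: vector_space "smult :: real \<Rightarrow> real poly \<Rightarrow> real poly"
  by unfold_locales (simp_all add: smult_add_left smult_add_right)

global_interpretation poly_vs_pair: vector_space_pair
  "smult :: real \<Rightarrow> real poly \<Rightarrow> real poly" "smult :: real \<Rightarrow> real poly \<Rightarrow> real poly"
  by unfold_locales

lemma independent_legendre: "poly_vs.independent (legendre ` {1..})"
proof
  assume "poly_vs.dependent (legendre ` {1..})"
  then obtain T u v0 where T: "finite T" "T \<subseteq> legendre ` {1..}"
    and s: "(\<Sum>v\<in>T. smult (u v) v) = 0" and v0: "v0 \<in> T" "u v0 \<noteq> 0"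
    unfolding poly_vs.dependent_explicit by blast
  define S where "S = {v \<in> T. u v \<noteq> 0}"
  have S: "finite S" "S \<noteq> {}" using T v0 by (auto simp: S_def)
  then obtain v where v: "v \<in> S" and mx: "\<And>w. w \<in> S \<Longrightarrow> degree w \<le> degree v"
    using Max_in[of "degree ` S"] Max_ge[of "degree ` S"]
    by (metis (no_types, lifting) finite_imageI image_iff image_is_empty imageI)
  have z: "u w * coeff w (degree v) = 0" if w: "w \<in> T - {v}" for w
  proof (cases "u w = 0")
    case False
    hence "degree w \<le> degree v" using w mx by (auto simp: S_def)
    moreover have "degree w \<noteq> degree v"
      using w v T(2) by (auto simp: S_def subset_iff image_iff) (metis degree_legendre)
    ultimately show ?thesis by (simp add: coeff_eq_0)
  qed simp
  have "0 = coeff (\<Sum>v\<in>T. smult (u v) v) (degree v)" by (simp add: s)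
  also have "\<dots> = (\<Sum>w\<in>T. u w * coeff w (degree v))" by (simp add: coeff_sum)
  also have "\<dots> = u v * coeff v (degree v) + (\<Sum>w\<in>T - {v}. u w * coeff w (degree v))"
    using v T(1) by (intro sum.remove) (auto simp: S_def)
  also have "(\<Sum>w\<in>T - {v}. u w * coeff w (degree v)) = 0"
    by (rule sum.neutral) (rule ballI, rule z)
  finally have "u v = 0 \<or> v = 0" by simp
  thus False using v T(2) by (auto simp: S_def)
qed

text \<open>The prescribed values of the operator on the basis \<open>L\<^sub>1, L\<^sub>2, \<dots>\<close>.  Since
  \<open>degree L\<^sub>j = j\<close>, the index of a basis vector is recovered as its degree.\<close>

definition Fop_basis :: "real poly \<Rightarrow> real poly" where
  "Fop_basis p = (let j = degree p in
     if j = 1 then smult (1 / 3) (legendre 2)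
     else smult (1 / real (2 * j + 1)) (legendre (j + 1) - legendre (j - 1)))"

text \<open>The linear extension of these values.  The library's \<open>construct\<close> yields a linear map on
  all of \<open>real poly\<close> (zero on an arbitrary complement of the span of \<open>L\<^sub>1, L\<^sub>2, \<dots>\<close>); only its
  restriction to that span, which it maps into itself, is meaningful.\<close>

definition Fop :: "real poly \<Rightarrow> real poly" where
  "Fop = poly_vs_pair.construct (legendre ` {1..}) Fop_basis"

lemma linear_Fop: "Vector_Spaces.linear smult smult Fop"
  unfolding Fop_def by (rule poly_vs_pair.linear_construct[OF independent_legendre])

lemma Fop_legendre_1: "Fop (legendre 1) = smult (1 / 3) (legendre 2)"
  unfolding Fop_def
  by (subst poly_vs_pair.construct_basis[OF independent_legendre]) (auto simp: Fop_basis_def)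

lemma Fop_legendre:
  assumes "j \<ge> 2"
  shows "Fop (legendre j) = smult (1 / real (2 * j + 1)) (legendre (j + 1) - legendre (j - 1))"
  unfolding Fop_def using assms
  by (subst poly_vs_pair.construct_basis[OF independent_legendre]) (auto simp: Fop_basis_def)

lemma Fop_span:
  assumes "p \<in> poly_vs.span (legendre ` {1..})"
  shows "Fop p \<in> poly_vs.span (legendre ` {1..})"
proof -
  let ?V = "poly_vs.span (legendre ` {1..})"
  have L: "legendre j \<in> ?V" if "j \<ge> 1" for j
    using that by (intro poly_vs.span_base) auto
  have "Fop (legendre j) \<in> ?V" if "j \<ge> 1" for j
  proof (cases "j = 1")
    case True
    thus ?thesis
      using poly_vs.span_scale[OF L[of 2]] by (simp only: Fop_legendre_1)
  next
    case False
    hence "j \<ge> 2" using that by simp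
    thus ?thesis
      unfolding Fop_legendre[OF \<open>j \<ge> 2\<close>]
      by (intro poly_vs.span_scale poly_vs.span_diff L) auto
  qed
  hence "Fop ` (legendre ` {1..}) \<subseteq> ?V" by auto
  hence "poly_vs.span (Fop ` (legendre ` {1..})) \<subseteq> ?V"
    by (simp add: poly_vs.span_minimal poly_vs.subspace_span)
  thus ?thesis
    using assms poly_vs_pair.linear_span_image[OF linear_Fop] by blast
qed

definition Fpoly :: "nat \<Rightarrow> real poly" where
  "Fpoly k = (Fop ^^ k) (legendre 1)"

end

theory Submission
  imports Defs "HOL-Analysis.Analysis"
begin

text \<open>The derivative of \<open>L\<^sub>j\<^sub>+\<^sub>1 - L\<^sub>j\<^sub>-\<^sub>1\<close> is \<open>(2 j + 1) L\<^sub>j\<close>, and this difference vanishes at \<open>\<plusminus>1\<close>.  Hence the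
operator takes antiderivatives, and the iterates are determined by \<open>F\<^sub>0 = t\<close>, \<open>F\<^sub>k\<^sub>+\<^sub>1' = F\<^sub>k\<close> and
\<open>F\<^sub>k\<^sub>+\<^sub>1(1) = F\<^sub>k\<^sub>+\<^sub>1(-1)\<close>: up to scaling and an affine change of variable they are the Bernoulli
polynomials \<open>B\<^sub>k\<^sub>+\<^sub>1\<close>.

The location of the zeros is the classical argument for Bernoulli polynomials.  The iterates alternate
in parity, so those of even positive index vanish at \<open>-1, 0, 1\<close>.  A further zero would, by Rolle's theorem
applied twice, descend to a zero of \<open>F\<^sub>0\<close> inside \<open>(0, 1)\<close> (\<open>Fpoly_even_no_zero\<close>).  Rolle's theorem between an
odd iterate and its two even neighbours then gives exactly one zero in \<open>(0, 1)\<close>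
(\<open>Fpoly_odd_unique_zero\<close>).  All zeros are simple because consecutive iterates have no common zero in
\<open>[-1, 1]\<close>.

For the asymptotics, put \<open>n = k + 1\<close> with \<open>k\<close> odd.  Integration by parts yields the cosine coefficients of
\<open>F\<^sub>k\<close> on \<open>[0, 1]\<close>, and since they are summable the cosine series represents \<open>F\<^sub>k\<close>
(\<open>cosine_series\<close>).  So the zero \<open>a\<close> satisfies
\<open>cos (\<pi> a) - cos (2 \<pi> a) / 2\<^sup>n + cos (3 \<pi> a) / 3\<^sup>n - \<dots> = 0\<close>.  With \<open>y = \<pi> (a - 1/2)\<close> this reads
\<open>sin y = cos (2 y) / 2\<^sup>n + sin (3 y) / 3\<^sup>n - cos (4 y) / 4\<^sup>n - \<dots>\<close>, which forces
\<open>y = O(2\<^sup>-\<^sup>n)\<close>.  Cutting off after the ninth term costs \<open>O(10\<^sup>-\<^sup>n)\<close>, and solving the remaining equation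
to this precision gives the expansion (\<open>sine_equation_expansion\<close>).\<close>

section \<open>Legendre polynomials and the operator\<close>

abbreviation square_minus_one :: "real poly" where "square_minus_one \<equiv> [:-1, 0, 1:]"

text \<open>The quadratic is kept abstract: what matters is that \<open>t * t\<close> can be traded for \<open>q + 1\<close>, which
turns the second derivative of a power of \<open>q\<close> into a combination of two powers of \<open>q\<close> alone.\<close>
lemma pderiv2_power_quadratic:
  fixes q t :: "real poly"
  assumes q: "pderiv q = smult 2 t" and t: "pderiv t = 1" and tt: "t * t = q + 1"
  shows "pderiv (pderiv (q ^ Suc (Suc n))) =
     smult (2 * (real n + 2) * (2 * real n + 3)) (q ^ Suc n) +
     smult (4 * (real n + 1) * (real n + 2)) (q ^ n)"
proof -
  have 1: "pderiv (q ^ Suc m) = smult (2 * (real m + 1)) (t * q ^ m)" for m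
    unfolding pderiv_power_Suc q by (simp add: mult_ac add_ac)
  have "pderiv (pderiv (q ^ Suc (Suc n))) =
      smult (2 * (real (Suc n) + 1)) (q ^ Suc n + smult (2 * (real n + 1)) ((t * t) * q ^ n))"
    unfolding 1 pderiv_smult pderiv_mult t
    by (simp only: mult_1_left mult_1_right mult_smult_right mult_smult_left mult.assoc add.commute)
  also have "(t * t) * q ^ n = q ^ Suc n + q ^ n"
    unfolding tt by (simp add: distrib_right)
  also have "smult (2 * (real (Suc n) + 1)) (q ^ Suc n + smult (2 * (real n + 1)) (q ^ Suc n + q ^ n)) =
      smult (2 * (real (Suc n) + 1) * (1 + 2 * (real n + 1))) (q ^ Suc n)
      + smult (2 * (real (Suc n) + 1) * (2 * (real n + 1))) (q ^ n)"
    by (simp only: smult_add_right smult_smult smult_add_left distrib_left mult_1_right add.assoc)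
  also have "\<dots> = smult (2 * (real n + 2) * (2 * real n + 3)) (q ^ Suc n) +
     smult (4 * (real n + 1) * (real n + 2)) (q ^ n)"
    by (intro arg_cong2[where f = "(+)"] arg_cong2[where f = smult] refl) (simp_all add: algebra_simps)
  finally show ?thesis .
qed

lemma pderiv2_square_minus_one_power: "pderiv (pderiv (square_minus_one ^ Suc (Suc n))) =
     smult (2 * (real n + 2) * (2 * real n + 3)) (square_minus_one ^ Suc n) +
     smult (4 * (real n + 1) * (real n + 2)) (square_minus_one ^ n)"
  by (rule pderiv2_power_quadratic[of _ "[:0, 1:]"]) (simp_all add: pderiv_pCons one_pCons)

text \<open>Two of the derivatives in Rodrigues' formula for \<open>L\<^sub>n\<^sub>+\<^sub>2\<close> are spent on
the power of \<open>t\<^sup>2 - 1\<close>.  The term in \<open>(t\<^sup>2 - 1)\<^sup>n\<close> is then exactly \<open>L\<^sub>n\<close>, and what remains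
has fewer derivatives than factors \<open>t\<^sup>2 - 1\<close>.  One formula thus yields both facts needed below: its
derivative is a multiple of \<open>L\<^sub>n\<^sub>+\<^sub>1\<close>, and it vanishes at \<open>\<plusminus>1\<close>.\<close>
lemma legendre_diff:
  "legendre (Suc (Suc n)) - legendre n =
     smult ((2 * real n + 3) / (2 ^ Suc n * fact (Suc n))) ((pderiv ^^ n) (square_minus_one ^ Suc n))"
proof -
  have "(pderiv ^^ Suc (Suc n)) (square_minus_one ^ Suc (Suc n)) = (pderiv ^^ n) (pderiv (pderiv (square_minus_one ^ Suc (Suc n))))"
    by (simp only: funpow_Suc_right o_apply)
  also have "\<dots> = smult (2 * (real n + 2) * (2 * real n + 3)) ((pderiv ^^ n) (square_minus_one ^ Suc n))
      + smult (4 * (real n + 1) * (real n + 2)) ((pderiv ^^ n) (square_minus_one ^ n))"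
    unfolding pderiv2_square_minus_one_power higher_pderiv_add higher_pderiv_smult ..
  finally have "legendre (Suc (Suc n)) = smult (1 / (2 ^ Suc (Suc n) * fact (Suc (Suc n))))
     (smult (2 * (real n + 2) * (2 * real n + 3)) ((pderiv ^^ n) (square_minus_one ^ Suc n))
      + smult (4 * (real n + 1) * (real n + 2)) ((pderiv ^^ n) (square_minus_one ^ n)))"
    unfolding legendre_def by simp
  also have "\<dots> = smult ((2 * real n + 3) / (2 ^ Suc n * fact (Suc n))) ((pderiv ^^ n) (square_minus_one ^ Suc n))
       + legendre n"
    unfolding smult_add_right smult_smult legendre_def
    by (intro arg_cong2[where f = "(+)"] arg_cong2[where f = smult] refl)
       (simp_all add: divide_simps, simp_all add: algebra_simps)
  finally show ?thesis by simp
qed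

lemma pderiv_legendre_diff:
  "pderiv (legendre (Suc (Suc n)) - legendre n) = smult (2 * real n + 3) (legendre (Suc n))"
  unfolding legendre_diff by (simp add: pderiv_smult legendre_def)

lemma power_dvd_higher_pderiv:
  fixes p q :: "real poly"
  assumes "q ^ (m + n) dvd p"
  shows "q ^ m dvd (pderiv ^^ n) p"
  using assms
proof (induction n arbitrary: m)
  case (Suc n)
  then have "q ^ Suc m dvd (pderiv ^^ n) p" using Suc.IH[of "Suc m"] by simp
  then obtain r where "(pderiv ^^ n) p = q ^ Suc m * r" ..
  then have "(pderiv ^^ Suc n) p = pderiv (q ^ Suc m) * r + q ^ Suc m * pderiv r"
    by (simp add: pderiv_mult)
  moreover have "q ^ m dvd pderiv (q ^ Suc m)"
    unfolding pderiv_power_Suc by (intro dvd_mult2 dvd_smult dvd_refl)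
  ultimately show ?case
    by (metis dvd_add dvd_mult2 dvd_power_le dvd_refl le_SucI le_refl)
qed simp

lemma legendre_endpoint_diff:
  assumes "c = 1 \<or> c = -1"
  shows "poly (legendre (Suc (Suc n))) c = poly (legendre n) c"
proof -
  have "square_minus_one = [:-c, 1:] * [:c, 1:]" using assms by auto
  then have "[:-c, 1:] ^ (1 + n) dvd square_minus_one ^ Suc n"
    by (metis dvd_power_same dvd_triv_left plus_1_eq_Suc)
  from power_dvd_higher_pderiv[OF this]
  have "poly ((pderiv ^^ n) (square_minus_one ^ Suc n)) c = 0"
    by (simp add: poly_eq_0_iff_dvd)
  then have "poly (legendre (Suc (Suc n)) - legendre n) c = 0"
    unfolding legendre_diff by simp
  then show ?thesis by simp
qed

lemma legendre_0: "legendre 0 = 1"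
  by (simp add: legendre_def)

lemma legendre_1: "legendre 1 = [:0, 1:]"
  by (simp add: legendre_def pderiv_pCons)

text \<open>The operator integrates: up to a factor, its value at \<open>L\<^sub>j\<close> is the difference
\<open>L\<^sub>j\<^sub>+\<^sub>1 - L\<^sub>j\<^sub>-\<^sub>1\<close>.  For \<open>L\<^sub>1\<close> the missing term \<open>L\<^sub>0\<close> is constant and
does not affect either property.\<close>
lemma Fop_legendre_properties:
  assumes "j \<ge> 1"
  shows "pderiv (Fop (legendre j)) = legendre j"
    and "poly (Fop (legendre j)) 1 = poly (Fop (legendre j)) (-1)"
proof -
  obtain n where n: "j = Suc n" using assms by (cases j) auto
  have "pderiv (Fop (legendre j)) = legendre j \<and>
     poly (Fop (legendre j)) 1 = poly (Fop (legendre j)) (-1)"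
  proof (cases "j = 1")
    case True
    then have "n = 0" using n by simp
    then show ?thesis using pderiv_legendre_diff[of 0] legendre_endpoint_diff[of 1 0]
        legendre_endpoint_diff[of "-1" 0]
      unfolding True Fop_legendre_1
      by (simp add: pderiv_smult pderiv_diff legendre_0 numeral_2_eq_2)
  next
    case False
    then have F: "Fop (legendre j) = smult (1 / real (2 * j + 1)) (legendre (Suc (Suc n)) - legendre n)"
      using Fop_legendre[of j] n by simp
    have "pderiv (Fop (legendre j)) = legendre j"
      unfolding F pderiv_smult pderiv_legendre_diff by (simp add: n add.commute)
    then show ?thesis unfolding F by (simp add: legendre_endpoint_diff)
  qed
  then show "pderiv (Fop (legendre j)) = legendre j"
    and "poly (Fop (legendre j)) 1 = poly (Fop (legendre j)) (-1)" by auto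
qed

lemma Fop_properties:
  assumes "p \<in> poly_vs.span (legendre ` {1..})"
  shows "pderiv (Fop p) = p" and "poly (Fop p) 1 = poly (Fop p) (-1)"
proof -
  interpret F: Vector_Spaces.linear smult smult Fop by (rule linear_Fop)
  have "pderiv (Fop p) = p \<and> poly (Fop p) 1 = poly (Fop p) (-1)"
    using assms
  proof (induction rule: poly_vs.span_induct_alt)
    case base
    then show ?case by (simp add: F.zero)
  next
    case (step c x y)
    then show ?case
      using Fop_legendre_properties
      by (auto simp: F.add F.scale pderiv_add pderiv_smult)
  qed
  then show "pderiv (Fop p) = p" and "poly (Fop p) 1 = poly (Fop p) (-1)" by auto
qed

section \<open>Parity and zeros of the iterates\<close>

lemma Fpoly_span: "Fpoly k \<in> poly_vs.span (legendre ` {1..})"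
proof (induction k)
  case 0
  show ?case unfolding Fpoly_def by (auto intro!: poly_vs.span_base)
next
  case (Suc k)
  then show ?case using Fop_span unfolding Fpoly_def by simp
qed

lemma Fpoly_0: "Fpoly 0 = [:0, 1:]"
  using legendre_1 by (simp add: Fpoly_def)

lemma pderiv_Fpoly: "pderiv (Fpoly (Suc k)) = Fpoly k"
  using Fop_properties(1)[OF Fpoly_span[of k]] by (simp add: Fpoly_def)

text \<open>As the integral of \<open>F\<^sub>k\<close> over \<open>[-1, 1]\<close> is \<open>F\<^sub>k\<^sub>+\<^sub>1(1) - F\<^sub>k\<^sub>+\<^sub>1(-1)\<close>, this says
that every iterate has mean zero, which fixes the constant of integration in
\<open>F\<^sub>k' = F\<^sub>k\<^sub>-\<^sub>1\<close>.\<close>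
lemma Fpoly_endpoints: "poly (Fpoly (Suc k)) 1 = poly (Fpoly (Suc k)) (-1)"
  using Fop_properties(2)[OF Fpoly_span[of k]] by (simp add: Fpoly_def)

lemma DERIV_Fpoly: "(poly (Fpoly (Suc k)) has_real_derivative poly (Fpoly k) t) (at t within A)"
  using poly_DERIV[of "Fpoly (Suc k)" t] DERIV_subset
  by (metis pderiv_Fpoly has_field_derivative_at_within)

lemma Fpoly_nonzero: "Fpoly k \<noteq> 0"
proof (induction k)
  case (Suc k)
  then show ?case using pderiv_Fpoly[of k] by auto
qed (simp add: Fpoly_0)

text \<open>Integrating a function of one parity gives the other parity up to a constant.  The constant is
excluded by integrating once more: it would make the endpoint values of the next iterate differ.\<close>
lemma Fpoly_minus: "poly (Fpoly k) (-t) = (-1) ^ Suc k * poly (Fpoly k) t"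
proof (induction k arbitrary: t)
  case 0
  show ?case by (simp add: Fpoly_0)
next
  case (Suc k)
  let ?s = "(-1) ^ Suc k :: real"
  \<comment> \<open>the part of the wrong parity\<close>
  define E where "E j u = poly (Fpoly j) u - (-1) ^ Suc j * poly (Fpoly j) (-u)" for j and u :: real
  have dE: "(E (Suc j) has_real_derivative E j u) (at u)" for j u
    unfolding E_def
    by (auto intro!: derivative_eq_intros DERIV_chain2[OF DERIV_Fpoly] simp: pderiv_Fpoly)
  have "E k u = 0" for u
    unfolding E_def using Suc[of u] by (simp add: power2_eq_square flip: power_add)
  then have "E (Suc k) u = E (Suc k) 0" for u
    using DERIV_const_ratio_const DERIV_isconst_all dE by metis
  then have const: "E (Suc k) u = E (Suc k) 0" for u by blast
  define D where "D u = E (Suc (Suc k)) u - E (Suc k) 0 * u" for u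
  have "(D has_real_derivative 0) (at u)" for u
    unfolding D_def using const[of u] by (auto intro!: derivative_eq_intros dE)
  then have D: "D 1 = D (-1)"
    using DERIV_isconst_all by blast
  have "E (Suc (Suc k)) 1 = E (Suc (Suc k)) (-1)"
    using Fpoly_endpoints[of "Suc k"] by (simp add: E_def)
  with D have "E (Suc k) 0 = 0" by (simp add: D_def)
  then have "E (Suc k) (-t) = 0" using const[of "-t"] by simp
  then show ?case by (simp add: E_def)
qed

lemma Fpoly_even_zeros:
  assumes "even k"
  shows "poly (Fpoly k) 0 = 0" and "k > 0 \<Longrightarrow> poly (Fpoly k) 1 = 0"
proof -
  show "poly (Fpoly k) 0 = 0" using Fpoly_minus[of k 0] assms by simp
  assume "k > 0"
  then obtain l where "k = Suc l" by (cases k) auto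
  then show "poly (Fpoly k) 1 = 0" using Fpoly_minus[of k 1] Fpoly_endpoints[of l] assms by simp
qed

lemma Fpoly_Rolle:
  assumes "a < b" "poly (Fpoly (Suc k)) a = 0" "poly (Fpoly (Suc k)) b = 0"
  obtains c where "a < c" "c < b" "poly (Fpoly k) c = 0"
proof -
  have "\<exists>c>a. c < b \<and> poly (Fpoly (Suc k)) b - poly (Fpoly (Suc k)) a = (b - a) * poly (Fpoly k) c"
    using MVT2[OF assms(1), of "poly (Fpoly (Suc k))" "poly (Fpoly k)"] DERIV_Fpoly by blast
  then show ?thesis using that assms by auto
qed

text \<open>Going down two indices: a zero inside \<open>(0, 1)\<close>, together with those at \<open>0\<close> and \<open>1\<close>, gives by Rolle
two zeros of the derivative and hence one of the second derivative, so that in the end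
\<open>F\<^sub>0(t) = t\<close> would vanish inside \<open>(0, 1)\<close>.\<close>
lemma Fpoly_even_no_zero:
  assumes "0 < t" "t < 1"
  shows "poly (Fpoly (2 * j)) t \<noteq> 0"
  using assms
proof (induction j arbitrary: t)
  case 0
  then show ?case by (simp add: Fpoly_0)
next
  case (Suc j)
  show ?case
  proof
    assume z: "poly (Fpoly (2 * Suc j)) t = 0"
    have e: "poly (Fpoly (2 * Suc j)) 0 = 0" "poly (Fpoly (2 * Suc j)) 1 = 0"
      using Fpoly_even_zeros[of "2 * Suc j"] by auto
    obtain c where c: "0 < c" "c < t" "poly (Fpoly (Suc (2 * j))) c = 0"
      using Fpoly_Rolle[of 0 t "Suc (2 * j)"] Suc.prems z e by auto
    obtain d where d: "t < d" "d < 1" "poly (Fpoly (Suc (2 * j))) d = 0"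
      using Fpoly_Rolle[of t 1 "Suc (2 * j)"] Suc.prems z e by auto
    obtain e where "c < e" "e < d" "poly (Fpoly (2 * j)) e = 0"
      using Fpoly_Rolle[of c d "2 * j"] c d by auto
    then show False using Suc.IH[of e] c d by auto
  qed
qed

text \<open>Existence is Rolle for the next iterate, which vanishes at \<open>0\<close> and \<open>1\<close>; two zeros would produce one
of the previous iterate inside \<open>(0, 1)\<close>.  Uniqueness is claimed on the closed interval because the
non-vanishing at \<open>0\<close> and \<open>1\<close> is what makes the zeros of the next iterate simple.\<close>
lemma Fpoly_odd_unique_zero:
  obtains a where "0 < a" "a < 1"
    "\<And>t. 0 \<le> t \<Longrightarrow> t \<le> 1 \<Longrightarrow> poly (Fpoly (Suc (2 * j))) t = 0 \<longleftrightarrow> t = a"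
proof -
  obtain a where a: "0 < a" "a < 1" "poly (Fpoly (Suc (2 * j))) a = 0"
    using Fpoly_Rolle[of 0 1 "Suc (2 * j)"] Fpoly_even_zeros[of "Suc (Suc (2 * j))"] by auto
  have "t = a" if "0 \<le> t" "t \<le> 1" "poly (Fpoly (Suc (2 * j))) t = 0" for t
  proof (rule ccontr)
    assume "t \<noteq> a"
    then consider "t < a" | "a < t" by linarith
    then show False
    proof cases
      case 1
      with that a obtain c where "t < c" "c < a" "poly (Fpoly (2 * j)) c = 0"
        using Fpoly_Rolle[of t a "2 * j"] by auto
      then show False using Fpoly_even_no_zero[of c j] that a by auto
    next
      case 2
      with that a obtain c where "a < c" "c < t" "poly (Fpoly (2 * j)) c = 0"
        using Fpoly_Rolle[of a t "2 * j"] by auto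
      then show False using Fpoly_even_no_zero[of c j] that a by auto
    qed
  qed
  with a that show ?thesis by blast
qed

lemma order_Fpoly_eq_1:
  assumes "poly (Fpoly (Suc k)) t = 0" "poly (Fpoly k) t \<noteq> 0"
  shows "order t (Fpoly (Suc k)) = 1"
proof -
  have "order t (Fpoly (Suc k)) \<noteq> 0"
    using assms Fpoly_nonzero order_root by blast
  then have "order t (Fpoly (Suc k)) = Suc (order t (Fpoly k))"
    using order_pderiv[of "Fpoly (Suc k)" t] Fpoly_nonzero[of "Suc k"] assms(1) by (simp add: pderiv_Fpoly)
  then show ?thesis using order_root assms(2) by (simp add: order_0I)
qed

lemma Fpoly_even_zero_set:
  assumes "even k" "k \<ge> 2"
  shows "{t \<in> {-1..1}. poly (Fpoly k) t = 0} = {-1, 0, 1}"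
    and "\<forall>t\<in>{-1, 0, 1}. order t (Fpoly k) = 1"
proof -
  obtain j where k: "k = Suc (Suc (2 * j))"
  proof -
    obtain i where "k = 2 * i" using assms by blast
    with assms that[of "i - 1"] show ?thesis by auto
  qed
  have z: "poly (Fpoly k) 0 = 0" "poly (Fpoly k) 1 = 0"
    using Fpoly_even_zeros[of k] assms by auto
  have z': "poly (Fpoly k) (-1) = 0"
    using z Fpoly_minus[of k 1] by simp
  have nz: "poly (Fpoly k) t \<noteq> 0" if "0 < t" "t < 1" for t
    using Fpoly_even_no_zero[OF that, of "Suc j"] k by simp
  have nz': "poly (Fpoly k) t \<noteq> 0" if "-1 < t" "t < 0" for t
    using nz[of "-t"] that Fpoly_minus[of k t] by auto
  show "{t \<in> {-1..1}. poly (Fpoly k) t = 0} = {-1, 0, 1}"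
  proof (intro equalityI subsetI)
    fix t :: real assume t: "t \<in> {t \<in> {-1..1}. poly (Fpoly k) t = 0}"
    then show "t \<in> {-1, 0, 1}" using nz[of t] nz'[of t] by force
  qed (use z z' in auto)
  obtain a where a: "0 < a" "a < 1"
    "\<And>t. 0 \<le> t \<Longrightarrow> t \<le> 1 \<Longrightarrow> poly (Fpoly (Suc (2 * j))) t = 0 \<longleftrightarrow> t = a"
    using Fpoly_odd_unique_zero[of j] by blast
  have "poly (Fpoly (Suc (2 * j))) 0 \<noteq> 0" "poly (Fpoly (Suc (2 * j))) 1 \<noteq> 0"
    using a(3)[of 0] a(3)[of 1] a(1,2) by auto
  moreover from this have "poly (Fpoly (Suc (2 * j))) (-1) \<noteq> 0"
    using Fpoly_minus[of "Suc (2 * j)" 1] by simp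
  ultimately show "\<forall>t\<in>{-1, 0, 1}. order t (Fpoly k) = 1"
    using order_Fpoly_eq_1[of "Suc (2 * j)"] z z' k by auto
qed

lemma Fpoly_odd_zero_set:
  assumes "odd k"
  obtains a where "0 < a" "a < 1" "{t \<in> {-1..1}. poly (Fpoly k) t = 0} = {-a, a}"
    "order (-a) (Fpoly k) = 1" "order a (Fpoly k) = 1"
proof -
  obtain j where k: "k = Suc (2 * j)" using assms by (auto elim: oddE)
  obtain a where a: "0 < a" "a < 1"
    "\<And>t. 0 \<le> t \<Longrightarrow> t \<le> 1 \<Longrightarrow> poly (Fpoly k) t = 0 \<longleftrightarrow> t = a"
    using Fpoly_odd_unique_zero[of j] k by blast
  have sym: "poly (Fpoly k) (-t) = poly (Fpoly k) t" for t
    using Fpoly_minus[of k t] assms by simp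
  have za: "poly (Fpoly k) a = 0" "poly (Fpoly k) (-a) = 0"
    using a(3)[of a] a(1,2) sym by auto
  have nz: "poly (Fpoly (2 * j)) a \<noteq> 0" "poly (Fpoly (2 * j)) (-a) \<noteq> 0"
    using Fpoly_even_no_zero[OF a(1,2), of j] Fpoly_minus[of "2 * j" a] by auto
  have "{t \<in> {-1..1}. poly (Fpoly k) t = 0} = {-a, a}"
  proof (intro equalityI subsetI)
    fix t :: real assume t: "t \<in> {t \<in> {-1..1}. poly (Fpoly k) t = 0}"
    then show "t \<in> {-a, a}" using a(3)[of t] a(3)[of "-t"] sym[of t] by force
  qed (use za a in auto)
  moreover have "order (-a) (Fpoly k) = 1" "order a (Fpoly k) = 1"
    using order_Fpoly_eq_1[of "2 * j"] za nz k by auto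
  ultimately show ?thesis using that a by blast
qed

section \<open>Cosine series with summable coefficients\<close>

text \<open>The product formula \<open>2 cos x cos (m x) = cos ((m + 1) x) + cos ((m - 1) x)\<close> exchanges a power of the
cosine for neighbouring frequencies; hence the induction on \<open>j\<close> has to treat all \<open>m\<close> at once.\<close>
lemma cosine_moments_zero:
  fixes f :: "real \<Rightarrow> real"
  assumes cont: "continuous_on {0..1} f"
    and zero: "\<And>m::nat. integral {0..1} (\<lambda>t. f t * cos (pi * m * t)) = 0"
  shows "integral {0..1} (\<lambda>t. f t * cos (pi * t) ^ j * cos (pi * real m * t)) = 0"
proof (induction j arbitrary: m)
  case 0
  show ?case using zero[of m] by simp
next
  case (Suc j)
  let ?I = "\<lambda>m. integral {0..1} (\<lambda>t. f t * cos (pi * t) ^ j * cos (pi * real m * t))"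
  show ?case
  proof (cases m)
    case 0
    then show ?thesis using Suc[of 1] by (simp add: mult_ac)
  next
    case (Suc n)
    have "f t * cos (pi * t) ^ Suc j * cos (pi * real m * t) =
        (f t * cos (pi * t) ^ j * cos (pi * real (m + 1) * t)
          + f t * cos (pi * t) ^ j * cos (pi * real n * t)) / 2" for t
    proof -
      have args: "pi * real (m + 1) * t = pi * real m * t + pi * t"
        "pi * real n * t = pi * real m * t - pi * t"
        by (simp_all add: Suc algebra_simps)
      have "cos (pi * real (m + 1) * t) + cos (pi * real n * t) = 2 * (cos (pi * t) * cos (pi * real m * t))"
        unfolding args cos_add cos_diff by simp
      then show ?thesis
        unfolding distrib_left[symmetric] by simp
    qed
    then have "integral {0..1} (\<lambda>t. f t * cos (pi * t) ^ Suc j * cos (pi * real m * t)) =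
        integral {0..1} (\<lambda>t. (f t * cos (pi * t) ^ j * cos (pi * real (m + 1) * t)
          + f t * cos (pi * t) ^ j * cos (pi * real n * t)) / 2)"
      by presburger
    also have "\<dots> = (?I (m + 1) + ?I n) / 2"
      unfolding integral_divide
      by (subst integral_add) (auto intro!: integrable_continuous_interval continuous_intros cont)
    finally show ?thesis unfolding Suc.IH by simp
  qed
qed

text \<open>In the variable \<open>x = cos (\<pi> t)\<close> the function becomes continuous on \<open>[-1, 1]\<close>, so a polynomial in \<open>x\<close>
approximates it uniformly.  It is orthogonal to all such polynomials, hence to itself.\<close>
lemma cosine_uniqueness:
  fixes f :: "real \<Rightarrow> real"
  assumes cont: "continuous_on {0..1} f"
    and zero: "\<And>m::nat. integral {0..1} (\<lambda>t. f t * cos (pi * m * t)) = 0"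
    and t: "t \<in> {0..1}"
  shows "f t = 0"
proof -
  define B where "B = integral {0..1} (\<lambda>t. \<bar>f t\<bar>)"
  have B: "0 \<le> B" unfolding B_def
    by (intro integral_nonneg integrable_continuous_interval continuous_intros cont) auto
  have small: "integral {0..1} (\<lambda>t. f t * f t) \<le> e * B" if e: "e > 0" for e
  proof -
    have im: "(\<lambda>x. arccos x / pi) ` {-1..1} \<subseteq> {0..1}"
      using arccos_lbound arccos_ubound by (auto simp: divide_simps)
    have ch: "continuous_on {-1..1} (\<lambda>x. f (arccos x / pi))"
      by (intro continuous_on_compose2[OF cont _ im] continuous_intros) auto
    obtain g where g: "real_polynomial_function g"
        "\<And>x. x \<in> {-1..1} \<Longrightarrow> \<bar>f (arccos x / pi) - g x\<bar> < e"
      using Stone_Weierstrass_real_polynomial_function[OF compact_Icc ch e] by blast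
    obtain a n where a: "g = (\<lambda>x. \<Sum>i\<le>n. a i * x ^ i)"
      using g(1) real_polynomial_function_iff_sum by blast
    have approx: "\<bar>f t - g (cos (pi * t))\<bar> \<le> e" if "t \<in> {0..1}" for t
    proof -
      have "pi * t \<le> pi" using that by (simp add: mult_left_le)
      then have "arccos (cos (pi * t)) / pi = t"
        using that by (subst arccos_cos) auto
      then show ?thesis using g(2)[of "cos (pi * t)"] by auto
    qed
    have cg: "continuous_on A (\<lambda>t. g (cos (pi * t)))" for A
      unfolding a by (intro continuous_intros)
    have "integral {0..1} (\<lambda>t. f t * g (cos (pi * t))) =
        integral {0..1} (\<lambda>t. \<Sum>i\<le>n. a i * (f t * cos (pi * t) ^ i * cos (pi * real 0 * t)))"
      unfolding a by (simp add: sum_distrib_left mult_ac)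
    also have "\<dots> = (\<Sum>i\<le>n. a i * integral {0..1} (\<lambda>t. f t * cos (pi * t) ^ i * cos (pi * real 0 * t)))"
      by (subst integral_sum) (auto intro!: integrable_continuous_interval continuous_intros cont)
    also have "\<dots> = 0"
      by (intro sum.neutral ballI) (subst cosine_moments_zero[OF cont zero], simp)
    finally have z: "integral {0..1} (\<lambda>t. f t * g (cos (pi * t))) = 0" .
    have "integral {0..1} (\<lambda>t. f t * f t) =
        integral {0..1} (\<lambda>t. f t * f t) - integral {0..1} (\<lambda>t. f t * g (cos (pi * t)))"
      by (simp add: z)
    also have "\<dots> = integral {0..1} (\<lambda>t. f t * f t - f t * g (cos (pi * t)))"
      by (rule integral_diff[symmetric]) (auto intro!: integrable_continuous_interval continuous_intros cont cg)
    also have "\<dots> \<le> integral {0..1} (\<lambda>t. e * \<bar>f t\<bar>)"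
    proof (intro integral_le integrable_continuous_interval continuous_intros cont cg)
      fix t :: real assume t: "t \<in> {0..1}"
      have "f t * f t - f t * g (cos (pi * t)) = f t * (f t - g (cos (pi * t)))"
        by (simp add: algebra_simps)
      also have "\<dots> \<le> \<bar>f t\<bar> * \<bar>f t - g (cos (pi * t))\<bar>"
        by (metis abs_ge_self abs_mult)
      also have "\<dots> \<le> \<bar>f t\<bar> * e" by (intro mult_left_mono approx t) auto
      finally show "f t * f t - f t * g (cos (pi * t)) \<le> e * \<bar>f t\<bar>" by (simp add: mult.commute)
    qed
    also have "\<dots> = e * B" unfolding B_def by simp
    finally show ?thesis .
  qed
  have "integral {0..1} (\<lambda>t. f t * f t) \<le> 0"
  proof (rule field_le_epsilon)
    fix d :: real assume d: "d > 0"
    have "d / (B + 1) * B \<le> d" using B d by (simp add: field_simps)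
    then show "integral {0..1} (\<lambda>t. f t * f t) \<le> 0 + d"
      using small[of "d / (B + 1)"] B d by simp
  qed
  moreover have "0 \<le> integral {0..1} (\<lambda>t. f t * f t)"
    by (intro integral_nonneg integrable_continuous_interval continuous_intros cont) auto
  ultimately have "integral {0..1} (\<lambda>t. f t * f t) = 0" by simp
  moreover have "continuous_on {0..1} (\<lambda>t. f t * f t)"
    by (intro continuous_intros cont)
  ultimately have "f t * f t = 0"
    using integral_eq_0_iff[of 0 1 "\<lambda>t. f t * f t"] t by simp
  then show ?thesis by simp
qed

lemma integral_cos_pi:
  "integral {0..1} (\<lambda>t. cos (pi * of_int k * t)) = (if k = 0 then 1 else 0)"
proof (cases "k = 0")
  case False
  have "((\<lambda>t. cos (pi * of_int k * t)) has_integral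
      sin (pi * of_int k * 1) / (pi * of_int k) - sin (pi * of_int k * 0) / (pi * of_int k)) {0..1}"
    using False
    by (intro fundamental_theorem_of_calculus)
       (auto intro!: derivative_eq_intros simp flip: has_real_derivative_iff_has_vector_derivative)
  then show ?thesis
    using False by (simp add: integral_unique sin_int_times_real mult.commute)
qed simp

lemma cosine_orthogonality:
  "integral {0..1} (\<lambda>t. cos (pi * real m * t) * cos (pi * real l * t)) =
     (if m \<noteq> l then 0 else if m = 0 then 1 else 1 / 2)"
proof -
  have "integral {0..1} (\<lambda>t. cos (pi * real m * t) * cos (pi * real l * t)) =
     integral {0..1} (\<lambda>t. (cos (pi * of_int (int m - int l) * t) + cos (pi * of_int (int m + int l) * t)) / 2)"
    by (simp only: cos_times_cos of_int_diff of_int_add of_int_of_nat_eq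
        distrib_left distrib_right right_diff_distrib left_diff_distrib)
  also have "\<dots> = (integral {0..1} (\<lambda>t. cos (pi * of_int (int m - int l) * t))
      + integral {0..1} (\<lambda>t. cos (pi * of_int (int m + int l) * t))) / 2"
    unfolding integral_divide
    by (subst integral_add) (auto intro!: integrable_continuous_interval continuous_intros)
  also have "\<dots> = (if m \<noteq> l then 0 else if m = 0 then 1 else 1 / 2)"
    unfolding integral_cos_pi by auto
  finally show ?thesis .
qed

text \<open>The series converges uniformly, so its sum is continuous and may be integrated term by term; it then has
the same cosine coefficients as \<open>f\<close>, and uniqueness applies to the difference.\<close>
lemma cosine_series:
  fixes f :: "real \<Rightarrow> real" and c :: "nat \<Rightarrow> real"
  assumes cont: "continuous_on {0..1} f"
    and c: "\<And>m. c m = integral {0..1} (\<lambda>t. f t * cos (pi * m * t))"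
    and summ: "summable (\<lambda>m. \<bar>c m\<bar>)"
    and t: "t \<in> {0..1}"
  shows "(\<lambda>m. (if m = 0 then 1 else 2) * c m * cos (pi * m * t)) sums f t"
proof -
  define u where "u m t = (if m = 0 then 1 else 2) * c m * cos (pi * m * t)" for m :: nat and t
  define S where "S t = (\<Sum>m. u m t)" for t
  have bound: "norm (u m t) \<le> 2 * \<bar>c m\<bar>" for m t
  proof -
    have "\<bar>c m\<bar> * \<bar>cos (pi * m * t)\<bar> \<le> \<bar>c m\<bar> * 1" by (intro mult_left_mono) auto
    then show ?thesis unfolding u_def by (auto simp: abs_mult)
  qed
  have summ2: "summable (\<lambda>m. 2 * \<bar>c m\<bar>)" using summ by (intro summable_mult)
  have ul: "uniform_limit {0..1} (\<lambda>n t. \<Sum>i<n. u i t) S sequentially"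
    unfolding S_def using bound summ2 by (intro Weierstrass_m_test)
  have cu: "continuous_on A (u m)" for A m
    unfolding u_def by (intro continuous_intros)
  have cS: "continuous_on {0..1} S"
    by (rule uniform_limit_theorem[OF _ ul]) (auto intro!: always_eventually continuous_intros cu)
  have coeff: "integral {0..1} (\<lambda>t. S t * cos (pi * real l * t)) = c l" for l
  proof -
    have "uniform_limit {0..1} (\<lambda>n t. (\<Sum>i<n. u i t) * cos (pi * real l * t))
        (\<lambda>t. S t * cos (pi * real l * t)) sequentially"
    proof (rule uniform_lim_mult[OF ul uniform_limit_const])
      show "bounded (S ` {0..1})"
        using compact_imp_bounded compact_continuous_image cS compact_Icc by blast
      show "bounded ((\<lambda>t. cos (pi * real l * t)) ` {0..1})"
        by (intro compact_imp_bounded compact_continuous_image continuous_intros) auto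
    qed
    then obtain I J where IJ:
      "\<And>n. ((\<lambda>t. (\<Sum>i<n. u i t) * cos (pi * real l * t)) has_integral I n) {0..1}"
      "((\<lambda>t. S t * cos (pi * real l * t)) has_integral J) {0..1}" "I \<longlonglongrightarrow> J"
      by (rule uniform_limit_integral) (auto intro!: continuous_intros cu)
    have "I n = c l" if "n > l" for n
    proof -
      have "I n = integral {0..1} (\<lambda>t. (\<Sum>i<n. u i t) * cos (pi * real l * t))"
        using IJ(1)[of n] by (simp add: integral_unique)
      also have "\<dots> = integral {0..1} (\<lambda>t. \<Sum>i<n. ((if i = 0 then 1 else 2) * c i) *
           (cos (pi * real i * t) * cos (pi * real l * t)))"
        by (simp add: u_def sum_distrib_left sum_distrib_right mult_ac)
      also have "\<dots> = (\<Sum>i<n. ((if i = 0 then 1 else 2) * c i) *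
          integral {0..1} (\<lambda>t. cos (pi * real i * t) * cos (pi * real l * t)))"
        by (subst integral_sum) (auto intro!: integrable_continuous_interval continuous_intros)
      also have "\<dots> = (\<Sum>i<n. if i = l then c l else 0)"
        unfolding cosine_orthogonality by (intro sum.cong) auto
      also have "\<dots> = c l" using that by simp
      finally show ?thesis .
    qed
    then have "I \<longlonglongrightarrow> c l"
      by (intro tendsto_eventually) (auto simp: eventually_sequentially intro!: exI[of _ "Suc l"])
    then have "J = c l" using IJ(3) LIMSEQ_unique by blast
    then show ?thesis using IJ(2) by (simp add: integral_unique)
  qed
  have "(\<lambda>t. f t - S t) t = 0"
  proof (rule cosine_uniqueness[OF _ _ t])
    show "continuous_on {0..1} (\<lambda>t. f t - S t)" by (intro continuous_intros cont cS)
    fix l :: nat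
    have "integral {0..1} (\<lambda>t. (f t - S t) * cos (pi * real l * t)) =
        integral {0..1} (\<lambda>t. f t * cos (pi * real l * t)) - integral {0..1} (\<lambda>t. S t * cos (pi * real l * t))"
      unfolding left_diff_distrib
      by (intro integral_diff integrable_continuous_interval continuous_intros cont cS)
    then show "integral {0..1} (\<lambda>t. (f t - S t) * cos (pi * real l * t)) = 0"
      by (simp add: coeff c)
  qed
  moreover have "summable (\<lambda>m. u m t)"
    using bound summ2 by (rule summable_comparison_test'[rotated])
  ultimately show ?thesis unfolding u_def S_def by (simp add: sums_iff)
qed

section \<open>The cosine series of the iterates\<close>

text \<open>Two integrations by parts.\<close>
lemma Fpoly_cosine_integral_step:
  assumes "v \<noteq> 0" "sin v = 0"
  shows "integral {0..1} (\<lambda>t. poly (Fpoly (Suc (Suc k))) t * cos (v * t)) =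
    (poly (Fpoly (Suc k)) 1 * cos v - poly (Fpoly (Suc k)) 0) / v\<^sup>2
    - integral {0..1} (\<lambda>t. poly (Fpoly k) t * cos (v * t)) / v\<^sup>2"
proof -
  let ?P = "\<lambda>k t. poly (Fpoly k) t"
  define G where "G t = ?P (Suc (Suc k)) t * sin (v * t) / v + ?P (Suc k) t * cos (v * t) / v\<^sup>2" for t
  have "((\<lambda>t. ?P (Suc (Suc k)) t * cos (v * t) + ?P k t * cos (v * t) / v\<^sup>2) has_integral G 1 - G 0) {0..1}"
  proof (rule fundamental_theorem_of_calculus)
    fix t :: real
    have "(G has_real_derivative ?P (Suc (Suc k)) t * cos (v * t) + ?P k t * cos (v * t) / v\<^sup>2)
        (at t within {0..1})"
      unfolding G_def using assms(1)
      by (auto intro!: derivative_eq_intros DERIV_chain2[OF DERIV_Fpoly] DERIV_Fpoly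
          simp: pderiv_Fpoly field_simps power2_eq_square)
    then show "(G has_vector_derivative ?P (Suc (Suc k)) t * cos (v * t) + ?P k t * cos (v * t) / v\<^sup>2)
        (at t within {0..1})"
      by (simp add: has_real_derivative_iff_has_vector_derivative)
  qed simp
  then have "integral {0..1} (\<lambda>t. ?P (Suc (Suc k)) t * cos (v * t) + ?P k t * cos (v * t) / v\<^sup>2) =
      (?P (Suc k) 1 * cos v - ?P (Suc k) 0) / v\<^sup>2"
    using assms by (simp add: integral_unique G_def diff_divide_distrib)
  also have "integral {0..1} (\<lambda>t. ?P (Suc (Suc k)) t * cos (v * t) + ?P k t * cos (v * t) / v\<^sup>2) =
     integral {0..1} (\<lambda>t. ?P (Suc (Suc k)) t * cos (v * t))
     + integral {0..1} (\<lambda>t. ?P k t * cos (v * t) / v\<^sup>2)"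
    using assms by (intro integral_add integrable_continuous_interval continuous_intros) auto
  finally show ?thesis by simp
qed

text \<open>For even iterates of positive index the boundary terms vanish, so each double step divides by
\<open>-(\<pi> m)\<^sup>2\<close>.  At \<open>m = 0\<close> the right-hand side is a division by zero, whose value \<open>0\<close> is the correct
coefficient, as the mean over \<open>[0, 1]\<close> vanishes.\<close>
lemma Fpoly_cosine_coefficient:
  "integral {0..1} (\<lambda>t. poly (Fpoly (Suc (2 * j))) t * cos (pi * real m * t)) =
     (-1) ^ (j + m) / (pi * real m) ^ (2 * j + 2)"
proof (cases "m = 0")
  case True
  have "(poly (Fpoly (Suc (2 * j))) has_integral
      poly (Fpoly (Suc (Suc (2 * j)))) 1 - poly (Fpoly (Suc (Suc (2 * j)))) 0) {0..1}"
    using DERIV_Fpoly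
    by (intro fundamental_theorem_of_calculus)
       (auto simp flip: has_real_derivative_iff_has_vector_derivative)
  then show ?thesis
    using True Fpoly_even_zeros[of "Suc (Suc (2 * j))"] by (simp add: integral_unique)
next
  case False
  define v where "v = pi * real m"
  have v: "v \<noteq> 0" "sin v = 0" "cos v = (-1) ^ m"
    using False by (auto simp: v_def sin_npi2 cos_npi2)
  have "integral {0..1} (\<lambda>t. poly (Fpoly (Suc (2 * j))) t * cos (v * t)) =
     (-1) ^ (j + m) / v ^ (2 * j + 2)"
  proof (induction j)
    case 0
    \<comment> \<open>integration by parts again, the derivative of \<open>F\<^sub>0\<close> being \<open>1\<close>\<close>
    define G where "G t = poly (Fpoly 1) t * sin (v * t) / v + t * cos (v * t) / v\<^sup>2 - sin (v * t) / v ^ 3" for t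
    have P: "poly (Fpoly 0) t = t" for t by (simp add: Fpoly_0)
    have "((\<lambda>t. poly (Fpoly 1) t * cos (v * t)) has_integral G 1 - G 0) {0..1}"
    proof (rule fundamental_theorem_of_calculus)
      fix t :: real
      have "(G has_real_derivative poly (Fpoly 1) t * cos (v * t)) (at t within {0..1})"
        unfolding G_def using v(1) DERIV_Fpoly[of 0]
        by (auto intro!: derivative_eq_intros
            simp: P field_simps power2_eq_square power3_eq_cube pderiv_Fpoly)
      then show "(G has_vector_derivative poly (Fpoly 1) t * cos (v * t)) (at t within {0..1})"
        by (simp add: has_real_derivative_iff_has_vector_derivative)
    qed simp
    then show ?case using v by (simp add: integral_unique G_def power2_eq_square)
  next
    case (Suc j)
    have "integral {0..1} (\<lambda>t. poly (Fpoly (Suc (2 * Suc j))) t * cos (v * t)) =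
        - ((-1) ^ (j + m) / v ^ (2 * j + 2)) / v\<^sup>2"
      using Fpoly_cosine_integral_step[OF v(1,2), of "Suc (2 * j)"]
        Fpoly_even_zeros[of "Suc (Suc (2 * j))"] by (simp add: Suc.IH)
    also have "\<dots> = (-1) ^ (Suc j + m) / v ^ (2 * Suc j + 2)"
      using v(1) by (simp add: field_simps power2_eq_square)
    finally show ?case .
  qed
  then show ?thesis unfolding v_def .
qed

lemma abs_minus_one_cos_le: "\<bar>(-1) ^ i * cos x / y\<bar> \<le> 1 / \<bar>y\<bar>" for x y :: real
  by (simp add: abs_mult divide_right_mono)

text \<open>The summand for \<open>m = 0\<close> is a division by zero and contributes nothing.\<close>
lemma Fpoly_cosine_series:
  assumes "t \<in> {0..1}"
  shows "(\<lambda>m. (-1) ^ m * cos (pi * real m * t) / real m ^ (2 * j + 2)) sums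
    ((-1) ^ j * pi ^ (2 * j + 2) / 2 * poly (Fpoly (Suc (2 * j))) t)"
proof -
  let ?c = "\<lambda>m. (-1) ^ (j + m) / (pi * real m) ^ (2 * j + 2)"
  have summ: "summable (\<lambda>m. \<bar>?c m\<bar>)"
  proof -
    have "summable (\<lambda>m. 1 / pi ^ (2 * j + 2) * (1 / real m ^ (2 * j + 2)))"
      using inverse_power_summable[of "2 * j + 2", where ?'a = real]
      by (intro summable_mult) (simp add: inverse_eq_divide)
    moreover have "\<bar>?c m\<bar> = 1 / pi ^ (2 * j + 2) * (1 / real m ^ (2 * j + 2))" for m
      unfolding power_mult_distrib abs_divide abs_mult by simp
    ultimately show ?thesis by (simp only:)
  qed
  have cont: "continuous_on {0..1} (poly (Fpoly (Suc (2 * j))))"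
    by (intro continuous_intros)
  have "(\<lambda>m. (if m = 0 then 1 else 2) * ?c m * cos (pi * real m * t)) sums poly (Fpoly (Suc (2 * j))) t"
    using cosine_series[OF cont Fpoly_cosine_coefficient[symmetric] summ assms] .
  then have "(\<lambda>m. (-1) ^ j * pi ^ (2 * j + 2) / 2 * ((if m = 0 then 1 else 2) * ?c m * cos (pi * real m * t)))
     sums ((-1) ^ j * pi ^ (2 * j + 2) / 2 * poly (Fpoly (Suc (2 * j))) t)"
    by (rule sums_mult)
  moreover have "(-1) ^ j * pi ^ (2 * j + 2) / 2 * ((if m = 0 then 1 else 2) * ?c m * cos (pi * real m * t))
     = (-1) ^ m * cos (pi * real m * t) / real m ^ (2 * j + 2)" for m
  proof -
    have "(-1 :: real) ^ j * (-1) ^ (j + m) = (-1) ^ m"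
      by (simp add: power_add flip: mult.assoc power_mult_distrib)
    then show ?thesis
      by (auto simp: power_mult_distrib field_simps)
  qed
  ultimately show ?thesis by simp
qed

text \<open>A single constant has to serve all exponents \<open>n\<close>.  Two of the \<open>n\<close> factors are kept to make the
series converge, and each of the others is bounded by \<open>1 / N\<close>.\<close>
lemma inverse_power_tail_bound:
  fixes x :: "nat \<Rightarrow> real"
  assumes "N > 0"
  obtains K where "\<And>n x. n \<ge> 2 \<Longrightarrow> (\<And>m. \<bar>x m\<bar> \<le> 1 / real (m + N) ^ n) \<Longrightarrow> \<bar>\<Sum>m. x m\<bar> \<le> K / real N ^ n"
proof
  fix n :: nat and x :: "nat \<Rightarrow> real"
  assume n: "n \<ge> 2" and x: "\<And>m. \<bar>x m\<bar> \<le> 1 / real (m + N) ^ n"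
  have s: "summable (\<lambda>m. 1 / real (m + N) ^ 2)"
    using inverse_power_summable[of 2, where ?'a = real]
    by (subst summable_iff_shift) (simp add: inverse_eq_divide)
  have b: "norm (x m) \<le> real N ^ 2 / real N ^ n * (1 / real (m + N) ^ 2)" for m
  proof -
    obtain l where l: "n = l + 2" using n by (metis le_add_diff_inverse2)
    have "1 / real (m + N) ^ n \<le> 1 / (real N ^ l * real (m + N) ^ 2)"
      unfolding l power_add using assms
      by (intro divide_left_mono mult_right_mono power_mono) auto
    also have "\<dots> = real N ^ 2 / real N ^ n * (1 / real (m + N) ^ 2)"
      unfolding l power_add using assms by simp
    finally show ?thesis using x[of m] by simp
  qed
  have "\<bar>\<Sum>m. x m\<bar> \<le> (\<Sum>m. real N ^ 2 / real N ^ n * (1 / real (m + N) ^ 2))"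
    using norm_suminf_le[of x, OF b summable_mult[OF s]] by (simp only: real_norm_def)
  also have "\<dots> = (real N ^ 2 * (\<Sum>m. 1 / real (m + N) ^ 2)) / real N ^ n"
    by (subst suminf_mult[OF s]) (simp only: times_divide_eq_left)
  finally show "\<bar>\<Sum>m. x m\<bar> \<le> (real N ^ 2 * (\<Sum>m. 1 / real (m + N) ^ 2)) / real N ^ n" .
qed

section \<open>Asymptotics of the positive zero\<close>

text \<open>At a zero the whole series sums to \<open>0\<close>, so a partial sum is as small as the tail.
The cases of interest are \<open>N = 2\<close>, which bounds the cosine of \<open>\<pi> a\<close>, and \<open>N = 10\<close>, which gives the
precision of the expansion.\<close>
lemma Fpoly_zero_truncated_series:
  assumes "N > 0"
  shows "\<exists>K. \<forall>k a. odd k \<longrightarrow> a \<in> {0..1} \<longrightarrow> poly (Fpoly k) a = 0 \<longrightarrow>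
    \<bar>\<Sum>m<N. (-1) ^ m * cos (pi * real m * a) / real m ^ (k + 1)\<bar> \<le> K / real N ^ (k + 1)"
proof -
  obtain K where K: "\<And>n x. n \<ge> 2 \<Longrightarrow> (\<And>m. \<bar>x m\<bar> \<le> 1 / real (m + N) ^ n) \<Longrightarrow> \<bar>\<Sum>m. x m\<bar> \<le> K / real N ^ n"
    using inverse_power_tail_bound[OF assms] by blast
  have "\<bar>\<Sum>m<N. (-1) ^ m * cos (pi * real m * a) / real m ^ (k + 1)\<bar> \<le> K / real N ^ (k + 1)"
    if k: "odd k" and a: "a \<in> {0..1}" "poly (Fpoly k) a = 0" for k a
  proof -
    define u where "u m = (-1) ^ m * cos (pi * real m * a) / real m ^ (k + 1)" for m
    obtain j where j: "k = Suc (2 * j)" using k by (auto elim: oddE)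
    have "u sums 0" unfolding u_def using Fpoly_cosine_series[OF a(1), of j] a(2) by (simp add: j)
    then have "(\<Sum>m. u (m + N)) = - (\<Sum>m<N. u m)"
      using suminf_minus_initial_segment[of u N] by (simp add: sums_iff)
    moreover have "\<bar>\<Sum>m. u (m + N)\<bar> \<le> K / real N ^ (k + 1)"
    proof (rule K)
      show "\<bar>u (m + N)\<bar> \<le> 1 / real (m + N) ^ (k + 1)" for m
        unfolding u_def using abs_minus_one_cos_le[of "m + N" _ "real (m + N) ^ (k + 1)"]
        by (simp del: of_nat_add)
    qed (simp add: j)
    ultimately show ?thesis by (simp add: u_def)
  qed
  then show ?thesis by blast
qed

lemma sin_taylor_bounds:
  fixes x :: real
  shows "\<bar>sin x\<bar> \<le> \<bar>x\<bar>" "\<bar>sin x - x\<bar> \<le> \<bar>x\<bar> ^ 3 / 6" "\<bar>sin x - (x - x ^ 3 / 6)\<bar> \<le> \<bar>x\<bar> ^ 5 / 120"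
proof -
  show "\<bar>sin x\<bar> \<le> \<bar>x\<bar>" by (rule abs_sin_x_le_abs_x)
  show "\<bar>sin x - x\<bar> \<le> \<bar>x\<bar> ^ 3 / 6"
    using Maclaurin_sin_bound[of x 3] by (simp add: eval_nat_numeral sin_coeff_Suc cos_coeff_Suc)
  show "\<bar>sin x - (x - x ^ 3 / 6)\<bar> \<le> \<bar>x\<bar> ^ 5 / 120"
    using Maclaurin_sin_bound[of x 5] by (simp add: eval_nat_numeral sin_coeff_Suc cos_coeff_Suc)
qed

lemma cos_taylor_bounds:
  fixes x :: real
  shows "\<bar>cos x - 1\<bar> \<le> \<bar>x\<bar> ^ 2 / 2" "\<bar>cos x - (1 - x ^ 2 / 2)\<bar> \<le> \<bar>x\<bar> ^ 4 / 24"
proof -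
  have le: "\<bar>cos t / c * x ^ n\<bar> \<le> \<bar>x\<bar> ^ n / c" if "c > 0" for t c n
    using that mult_right_mono[of "\<bar>cos t\<bar>" 1 "\<bar>x\<bar> ^ n"] by (simp add: abs_mult power_abs divide_right_mono)
  obtain t where "cos x = (\<Sum>m<2. cos_coeff m * x ^ m) + cos (t + 1/2 * real 2 * pi) / fact 2 * x ^ 2"
    using Maclaurin_cos_expansion[of x 2] by blast
  then show "\<bar>cos x - 1\<bar> \<le> \<bar>x\<bar> ^ 2 / 2"
    using le[of 2 "t + pi" 2] by (simp add: eval_nat_numeral sin_coeff_Suc cos_coeff_Suc)
  obtain t where "cos x = (\<Sum>m<4. cos_coeff m * x ^ m) + cos (t + 1/2 * real 4 * pi) / fact 4 * x ^ 4"
    using Maclaurin_cos_expansion[of x 4] by blast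
  then show "\<bar>cos x - (1 - x ^ 2 / 2)\<bar> \<le> \<bar>x\<bar> ^ 4 / 24"
    using le[of 24 "t + 2 * pi" 4] by (simp add: eval_nat_numeral sin_coeff_Suc cos_coeff_Suc)
qed

lemma abs_le_2_abs_sin:
  fixes y :: real
  assumes "\<bar>y\<bar> \<le> pi / 2"
  shows "\<bar>y\<bar> \<le> 2 * \<bar>sin y\<bar>"
proof -
  have "pi \<le> 16 / 5" using pi_approx(2) by simp
  then have "\<bar>y\<bar> \<le> 8 / 5" using assms by linarith
  then have "\<bar>y\<bar>\<^sup>2 \<le> (8 / 5)\<^sup>2" by (intro power_mono) auto
  then have "\<bar>y\<bar> ^ 3 \<le> 3 * \<bar>y\<bar>"
    using mult_right_mono[of "\<bar>y\<bar>\<^sup>2" 3 "\<bar>y\<bar>"] by (simp add: power3_eq_cube power2_eq_square)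
  then show ?thesis using sin_taylor_bounds(2)[of y] by linarith
qed

text \<open>With \<open>a = 1/2 + y/\<pi>\<close> the \<open>m\<close>-th cosine is \<open>cos (m y + m \<pi>/2)\<close>, which is a sine or cosine of \<open>m y\<close>
depending on \<open>m\<close> modulo \<open>4\<close>.\<close>
lemma cosine_terms_at_half:
  assumes "y = pi * (a - 1 / 2)"
  shows "(\<Sum>m<10. (-1) ^ m * cos (pi * real m * a) / real m ^ Suc k) =
    sin y - cos (2 * y) / 2 ^ Suc k - sin (3 * y) / 3 ^ Suc k + cos (4 * y) / 4 ^ Suc k
    + sin (5 * y) / 5 ^ Suc k - cos (6 * y) / 6 ^ Suc k - sin (7 * y) / 7 ^ Suc k
    + cos (8 * y) / 8 ^ Suc k + sin (9 * y) / 9 ^ Suc k"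
proof -
  have c: "cos (z + pi / 2) = - sin z" "cos (z + pi) = - cos z" for z :: real
    by (simp_all add: cos_add)
  have per: "cos (z + pi / 2 * real (l + 4)) = cos (z + pi / 2 * real l)" for z l
    by (simp add: cos_periodic algebra_simps flip: cos_periodic[of "z + pi * real l / 2"])
  have shift: "pi * real m * a = real m * y + pi / 2 * real m" for m
    unfolding assms by (simp add: algebra_simps)
  have low: "cos (z + pi / 2 * real 0) = cos z" "cos (z + pi / 2 * real 1) = - sin z"
    "cos (z + pi / 2 * real 2) = - cos z" "cos (z + pi / 2 * real 3) = sin z" for z :: real
  proof -
    show "cos (z + pi / 2 * real 3) = sin z"
      using c(1)[of "z + pi"] by (simp add: algebra_simps)
  qed (simp_all add: c)
  have high: "cos (z + pi / 2 * real 4) = cos z" "cos (z + pi / 2 * real 5) = - sin z"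
    "cos (z + pi / 2 * real 6) = - cos z" "cos (z + pi / 2 * real 7) = sin z"
    "cos (z + pi / 2 * real 8) = cos z" "cos (z + pi / 2 * real 9) = - sin z" for z :: real
    using per[of z 0] per[of z 1] per[of z 2] per[of z 3] per[of z 4] per[of z 5] low[of z]
    by simp_all
  have "{..<10::nat} = {0,1,2,3,4,5,6,7,8,9}" by auto
  then show ?thesis
    unfolding shift using low high by simp
qed

lemma bigo_power_times_geometric:
  fixes y :: "nat \<Rightarrow> real"
  assumes y: "y \<in> O[F](\<lambda>k. 1 / 2 ^ Suc k)" and q: "q > 0" "s > 0" "s \<le> 2 ^ p * q"
  shows "(\<lambda>k. y k ^ p / q ^ Suc k) \<in> O[F](\<lambda>k. 1 / s ^ Suc k)"
proof -
  have "(\<lambda>k. y k ^ p * (1 / q ^ Suc k)) \<in> O[F](\<lambda>k. (1 / 2 ^ Suc k) ^ p * (1 / q ^ Suc k))"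
    by (intro landau_o.big.mult landau_o.big_power y) simp
  also have "(\<lambda>k. (1 / 2 ^ Suc k) ^ p * (1 / q ^ Suc k)) \<in> O[F](\<lambda>k. 1 / s ^ Suc k)"
  proof (intro bigoI[where c = 1] always_eventually allI)
    fix k
    have "(1 / 2 ^ Suc k) ^ p * (1 / q ^ Suc k) = 1 / (2 ^ p * q) ^ Suc k"
      by (simp only: power_mult_distrib power_divide power_one flip: power_mult) (simp add: mult.commute)
    also have "\<dots> \<le> 1 / s ^ Suc k"
      using q by (intro divide_left_mono power_mono mult_pos_pos zero_less_power) auto
    finally show "norm ((1 / 2 ^ Suc k) ^ p * (1 / q ^ Suc k)) \<le> 1 * norm (1 / s ^ Suc k)"
      using q by simp
  qed
  finally show ?thesis by simp
qed

text \<open>An error of order \<open>y\<^sup>p\<close> in the numerator of the term with denominator \<open>q\<^sup>k\<^sup>+\<^sup>1\<close> has size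
\<open>(2\<^sup>p q)\<^sup>-\<^sup>(\<^sup>k\<^sup>+\<^sup>1\<^sup>)\<close>.  This decides how far each sine and cosine must be expanded to reach a given
precision \<open>s\<close>.\<close>
lemma bigo_taylor_error:
  fixes y :: "nat \<Rightarrow> real"
  assumes y: "y \<in> O[F](\<lambda>k. 1 / 2 ^ Suc k)" and q: "q > 0" "s > 0" "s \<le> 2 ^ p * q"
    and e: "\<And>k. \<bar>e k\<bar> \<le> C * \<bar>y k\<bar> ^ p"
  shows "(\<lambda>k. e k / q ^ Suc k) \<in> O[F](\<lambda>k. 1 / s ^ Suc k)"
proof -
  have "(\<lambda>k. e k / q ^ Suc k) \<in> O[F](\<lambda>k. y k ^ p / q ^ Suc k)"
  proof (intro bigoI[where c = C] always_eventually allI)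
    fix k
    show "norm (e k / q ^ Suc k) \<le> C * norm (y k ^ p / q ^ Suc k)"
      using divide_right_mono[OF e[of k], of "q ^ Suc k"] q(1) by (simp add: abs_mult power_abs)
  qed
  also have "(\<lambda>k. y k ^ p / q ^ Suc k) \<in> O[F](\<lambda>k. 1 / s ^ Suc k)"
    by (rule bigo_power_times_geometric[OF y q])
  finally show ?thesis .
qed

text \<open>Expanding every term to precision \<open>10\<^sup>-\<^sup>(\<^sup>k\<^sup>+\<^sup>1\<^sup>)\<close> leaves, with \<open>e\<^sub>q = q\<^sup>-\<^sup>(\<^sup>k\<^sup>+\<^sup>1\<^sup>)\<close>,
\<open>y = y\<^sup>3/6 + (1 - 2 y\<^sup>2) e\<^sub>2 + 3 y e\<^sub>3 - e\<^sub>4 + e\<^sub>6 - e\<^sub>8\<close>.  Reading it to precision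
\<open>4\<^sup>-\<^sup>(\<^sup>k\<^sup>+\<^sup>1\<^sup>)\<close> gives \<open>y = e\<^sub>2\<close> up to an error \<open>d\<close>, and this crude value suffices on the right-hand side:
there \<open>y\<close> occurs only multiplied by factors of size at most \<open>e\<^sub>3\<close>, so \<open>d\<close> contributes
\<open>O(12\<^sup>-\<^sup>(\<^sup>k\<^sup>+\<^sup>1\<^sup>))\<close>.  Collecting terms, \<open>e\<^sub>6\<close> receives \<open>3 + 1 = 4\<close> and \<open>e\<^sub>8\<close> receives
\<open>1/6 - 2 - 1 = -17/6\<close>.\<close>
lemma sine_equation_expansion:
  fixes y :: "nat \<Rightarrow> real"
  assumes y: "y \<in> O[F](\<lambda>k. 1 / 2 ^ Suc k)"
    and eq: "(\<lambda>k. sin (y k) - cos (2 * y k) / 2 ^ Suc k - sin (3 * y k) / 3 ^ Suc k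
      + cos (4 * y k) / 4 ^ Suc k + sin (5 * y k) / 5 ^ Suc k - cos (6 * y k) / 6 ^ Suc k
      - sin (7 * y k) / 7 ^ Suc k + cos (8 * y k) / 8 ^ Suc k + sin (9 * y k) / 9 ^ Suc k)
      \<in> O[F](\<lambda>k. 1 / 10 ^ Suc k)" (is "?E \<in> _")
  shows "(\<lambda>k. y k - (1 / 2 ^ Suc k - 1 / 4 ^ Suc k + 4 / 6 ^ Suc k - 17 / 6 / 8 ^ Suc k))
    \<in> O[F](\<lambda>k. 1 / 10 ^ Suc k)"
proof -
  define e where "e q k = 1 / q ^ Suc k" for q :: real and k :: nat
  have y': "y \<in> O[F](e 2)" and eq': "?E \<in> O[F](e 10)"
    unfolding e_def by (fact y, fact eq)
  have e_fun: "e q = (\<lambda>k. 1 / q ^ Suc k)" for q by (rule ext) (rule e_def)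
  note bt = bigo_taylor_error[OF y, of _ 10, folded e_def]
  note geo = bigo_power_times_geometric[OF y, folded e_def]
  have err:
    "(\<lambda>k. (sin (y k) - (y k - y k ^ 3 / 6)) / 1 ^ Suc k) \<in> O[F](e 10)"
    "(\<lambda>k. (cos (2 * y k) - (1 - (2 * y k) ^ 2 / 2)) / 2 ^ Suc k) \<in> O[F](e 10)"
    "(\<lambda>k. (sin (3 * y k) - 3 * y k) / 3 ^ Suc k) \<in> O[F](e 10)"
    "(\<lambda>k. (cos (4 * y k) - 1) / 4 ^ Suc k) \<in> O[F](e 10)"
    "(\<lambda>k. sin (5 * y k) / 5 ^ Suc k) \<in> O[F](e 10)"
    "(\<lambda>k. (cos (6 * y k) - 1) / 6 ^ Suc k) \<in> O[F](e 10)"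
    "(\<lambda>k. sin (7 * y k) / 7 ^ Suc k) \<in> O[F](e 10)"
    "(\<lambda>k. (cos (8 * y k) - 1) / 8 ^ Suc k) \<in> O[F](e 10)"
    "(\<lambda>k. sin (9 * y k) / 9 ^ Suc k) \<in> O[F](e 10)"
  proof -
    show "(\<lambda>k. (sin (y k) - (y k - y k ^ 3 / 6)) / 1 ^ Suc k) \<in> O[F](e 10)"
      using sin_taylor_bounds(3)[of "y _"] by (intro bt[where p = 5 and C = "1 / 120"]) auto
    show "(\<lambda>k. (cos (2 * y k) - (1 - (2 * y k) ^ 2 / 2)) / 2 ^ Suc k) \<in> O[F](e 10)"
      using cos_taylor_bounds(2)[of "2 * y _"]
      by (intro bt[where p = 4 and C = "2 / 3"]) (auto simp: abs_mult power_mult_distrib)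
    show "(\<lambda>k. (sin (3 * y k) - 3 * y k) / 3 ^ Suc k) \<in> O[F](e 10)"
      using sin_taylor_bounds(2)[of "3 * y _"]
      by (intro bt[where p = 3 and C = "9 / 2"]) (auto simp: abs_mult power_mult_distrib)
    show "(\<lambda>k. (cos (4 * y k) - 1) / 4 ^ Suc k) \<in> O[F](e 10)"
      using cos_taylor_bounds(1)[of "4 * y _"]
      by (intro bt[where p = 2 and C = 8]) (auto simp: abs_mult power_mult_distrib)
    show "(\<lambda>k. (cos (6 * y k) - 1) / 6 ^ Suc k) \<in> O[F](e 10)"
      using cos_taylor_bounds(1)[of "6 * y _"]
      by (intro bt[where p = 2 and C = 18]) (auto simp: abs_mult power_mult_distrib)
    show "(\<lambda>k. (cos (8 * y k) - 1) / 8 ^ Suc k) \<in> O[F](e 10)"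
      using cos_taylor_bounds(1)[of "8 * y _"]
      by (intro bt[where p = 2 and C = 32]) (auto simp: abs_mult power_mult_distrib)
    show "(\<lambda>k. sin (5 * y k) / 5 ^ Suc k) \<in> O[F](e 10)"
      using sin_taylor_bounds(1)[of "5 * y _"] by (intro bt[where p = 1 and C = 5]) (auto simp: abs_mult)
    show "(\<lambda>k. sin (7 * y k) / 7 ^ Suc k) \<in> O[F](e 10)"
      using sin_taylor_bounds(1)[of "7 * y _"] by (intro bt[where p = 1 and C = 7]) (auto simp: abs_mult)
    show "(\<lambda>k. sin (9 * y k) / 9 ^ Suc k) \<in> O[F](e 10)"
      using sin_taylor_bounds(1)[of "9 * y _"] by (intro bt[where p = 1 and C = 9]) (auto simp: abs_mult)
  qed
  \<comment> \<open>the defect of the truncated equation\<close>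
  define R where "R k = y k - y k ^ 3 / 6 - (1 - 2 * y k ^ 2) / 2 ^ Suc k - 3 * y k / 3 ^ Suc k
    + 1 / 4 ^ Suc k - 1 / 6 ^ Suc k + 1 / 8 ^ Suc k" for k
  have "(\<lambda>k. ?E k - (sin (y k) - (y k - y k ^ 3 / 6)) / 1 ^ Suc k
     + (cos (2 * y k) - (1 - (2 * y k) ^ 2 / 2)) / 2 ^ Suc k
     + (sin (3 * y k) - 3 * y k) / 3 ^ Suc k - (cos (4 * y k) - 1) / 4 ^ Suc k
     - sin (5 * y k) / 5 ^ Suc k + (cos (6 * y k) - 1) / 6 ^ Suc k + sin (7 * y k) / 7 ^ Suc k
     - (cos (8 * y k) - 1) / 8 ^ Suc k - sin (9 * y k) / 9 ^ Suc k) \<in> O[F](e 10)"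
    by (intro sum_in_bigo eq' err)
  also have "(\<lambda>k. ?E k - (sin (y k) - (y k - y k ^ 3 / 6)) / 1 ^ Suc k
     + (cos (2 * y k) - (1 - (2 * y k) ^ 2 / 2)) / 2 ^ Suc k
     + (sin (3 * y k) - 3 * y k) / 3 ^ Suc k - (cos (4 * y k) - 1) / 4 ^ Suc k
     - sin (5 * y k) / 5 ^ Suc k + (cos (6 * y k) - 1) / 6 ^ Suc k + sin (7 * y k) / 7 ^ Suc k
     - (cos (8 * y k) - 1) / 8 ^ Suc k - sin (9 * y k) / 9 ^ Suc k) = R"
    by (rule ext) (simp add: R_def diff_divide_distrib power_mult_distrib del: power_Suc)
  finally have R: "R \<in> O[F](e 10)" .

  define d where "d k = y k - e 2 k" for k
  have e4: "e q \<in> O[F](e 4)" if "q \<ge> 4" for q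
    using geo[of q 4 0] that by (simp add: e_fun del: power_Suc)
  have low: "(\<lambda>k. y k ^ 3 / 1 ^ Suc k) \<in> O[F](e 4)" "(\<lambda>k. y k ^ 2 / 2 ^ Suc k) \<in> O[F](e 4)"
    "(\<lambda>k. y k ^ 1 / 3 ^ Suc k) \<in> O[F](e 4)"
    by (rule geo; simp)+
  have "(\<lambda>k. R k + 1/6 * (y k ^ 3 / 1 ^ Suc k) - 2 * (y k ^ 2 / 2 ^ Suc k) + 3 * (y k ^ 1 / 3 ^ Suc k)
      - e 4 k + e 6 k - e 8 k) \<in> O[F](e 4)"
  proof (intro sum_in_bigo landau_o.big.cmult_in_iff[THEN iffD2] disjI2 impI)
    show "R \<in> O[F](e 4)" using landau_o.big_trans[OF R e4[of 10]] by simp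
  qed (fact low | (rule e4; simp) | simp)+
  also have "(\<lambda>k. R k + 1/6 * (y k ^ 3 / 1 ^ Suc k) - 2 * (y k ^ 2 / 2 ^ Suc k) + 3 * (y k ^ 1 / 3 ^ Suc k)
      - e 4 k + e 6 k - e 8 k) = d"
    by (rule ext) (simp add: R_def d_def e_def diff_divide_distrib del: power_Suc)
  finally have d: "d \<in> O[F](e 4)" .

  have prod: "(\<lambda>k. d k * g k) \<in> O[F](e 10)" if "g \<in> O[F](e r)" "r \<ge> 5 / 2" for g r
  proof -
    have "(\<lambda>k. d k * g k) \<in> O[F](\<lambda>k. e 4 k * e r k)"
      by (intro landau_o.big.mult d that)
    also have "(\<lambda>k. e 4 k * e r k) = e (4 * r)"
      by (simp add: e_def power_mult_distrib fun_eq_iff del: power_Suc)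
    also have "e (4 * r) \<in> O[F](e 10)"
      using geo[of "4 * r" 10 0] that(2) by (simp add: e_fun del: power_Suc)
    finally show ?thesis .
  qed
  have ee: "e q k * e r k = e (q * r) k" for q r k
    by (simp add: e_def power_mult_distrib)
  have y2: "(\<lambda>k. y k * y k) \<in> O[F](e 4)" "(\<lambda>k. y k * e 2 k) \<in> O[F](e 4)"
    using landau_o.big.mult[OF y' y'] landau_o.big.mult[OF y' landau_o.big_refl[of "e 2"]]
    by (simp_all add: ee)
  \<comment> \<open>replacing \<open>u\<close> by \<open>p = e\<^sub>2\<close> in the nonlinear terms, the changes written as multiples of \<open>u - p\<close>\<close>
  have alg: "(u - u ^ 3 / 6 - (1 - 2 * u\<^sup>2) * p - 3 * u * q + p\<^sup>2 - p * q + p ^ 3)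
      + 1 / 6 * ((u - p) * (u * u + u * p + p\<^sup>2)) - 2 * ((u - p) * (u * p + p\<^sup>2)) + 3 * ((u - p) * q)
      = u - (p - p\<^sup>2 + 4 * (p * q) - 17 / 6 * p ^ 3)" for u p q :: real
    by (simp add: algebra_simps power2_eq_square power3_eq_cube)
  have "(\<lambda>k. d k * (y k * y k + y k * e 2 k + e 4 k)) \<in> O[F](e 10)"
    "(\<lambda>k. d k * (y k * e 2 k + e 4 k)) \<in> O[F](e 10)"
    "(\<lambda>k. d k * e 3 k) \<in> O[F](e 10)"
    using prod[of _ 4, OF sum_in_bigo(1)[OF sum_in_bigo(1)[OF y2] landau_o.big_refl]]
      prod[of _ 4, OF sum_in_bigo(1)[OF y2(2) landau_o.big_refl]] prod[of _ 3, OF landau_o.big_refl]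
    by simp_all
  then have "(\<lambda>k. R k + 1 / 6 * (d k * (y k * y k + y k * e 2 k + e 4 k))
      - 2 * (d k * (y k * e 2 k + e 4 k)) + 3 * (d k * e 3 k)) \<in> O[F](e 10)"
    by (intro sum_in_bigo R) simp_all
  also have "(\<lambda>k. R k + 1 / 6 * (d k * (y k * y k + y k * e 2 k + e 4 k))
      - 2 * (d k * (y k * e 2 k + e 4 k)) + 3 * (d k * e 3 k)) =
     (\<lambda>k. y k - (1 / 2 ^ Suc k - 1 / 4 ^ Suc k + 4 / 6 ^ Suc k - 17 / 6 / 8 ^ Suc k))"
  proof
    fix k
    have pw: "e 4 k = (e 2 k)\<^sup>2" "e 6 k = e 2 k * e 3 k" "e 8 k = e 2 k ^ 3"
      using ee[of 2 k 2] ee[of 2 k 3] ee[of 2 k 4] by (simp_all add: power2_eq_square power3_eq_cube mult.commute)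
    have "R k = y k - y k ^ 3 / 6 - (1 - 2 * (y k)\<^sup>2) * e 2 k - 3 * y k * e 3 k + e 4 k - e 6 k + e 8 k"
      by (simp add: R_def e_def del: power_Suc)
    moreover have "1 / 2 ^ Suc k - 1 / 4 ^ Suc k + 4 / 6 ^ Suc k - 17 / 6 / 8 ^ Suc k =
        e 2 k - e 4 k + 4 * e 6 k - 17 / 6 * e 8 k"
      by (simp add: e_def del: power_Suc)
    ultimately show "R k + 1 / 6 * (d k * (y k * y k + y k * e 2 k + e 4 k))
      - 2 * (d k * (y k * e 2 k + e 4 k)) + 3 * (d k * e 3 k)
      = y k - (1 / 2 ^ Suc k - 1 / 4 ^ Suc k + 4 / 6 ^ Suc k - 17 / 6 / 8 ^ Suc k)"
      unfolding d_def pw using alg[of "y k" "e 2 k" "e 3 k"] by (simp only:)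
  qed
  finally show ?thesis unfolding e_def .
qed

theorem lemma4p11:
  shows "(\<forall>k\<ge>2. even k \<longrightarrow>
            {t \<in> {-1..1}. poly (Fpoly k) t = 0} = {-1, 0, 1} \<and>
            (\<forall>t\<in>{-1, 0, 1}. order t (Fpoly k) = 1)) \<and>
         (\<exists>a :: nat \<Rightarrow> real.
            (\<forall>k\<ge>2. odd k \<longrightarrow>
               a k \<in> {0<..<1} \<and>
               {t \<in> {-1..1}. poly (Fpoly k) t = 0} = {- a k, a k} \<and>
               order (- a k) (Fpoly k) = 1 \<and> order (a k) (Fpoly k) = 1) \<and>
            (a \<longlongrightarrow> 1 / 2) (inf sequentially (principal {k. odd k})) \<and>
            (\<lambda>k. a k - 1 / 2 -
                 (1 / (pi * 2 ^ (k + 1)) - 1 / (pi * 4 ^ (k + 1))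
                  + 4 / (pi * 6 ^ (k + 1)) - 17 / (6 * pi * 8 ^ (k + 1))))
              \<in> O[inf sequentially (principal {k. odd k})](\<lambda>k. 1 / 10 ^ (k + 1)))"
proof (intro conjI)
  show "\<forall>k\<ge>2. even k \<longrightarrow>
            {t \<in> {-1..1}. poly (Fpoly k) t = 0} = {-1, 0, 1} \<and>
            (\<forall>t\<in>{-1, 0, 1}. order t (Fpoly k) = 1)"
    using Fpoly_even_zero_set by blast
next
  define Q where "Q k a \<longleftrightarrow> 0 < a \<and> a < 1 \<and> {t \<in> {-1..1}. poly (Fpoly k) t = 0} = {-a, a}
      \<and> order (-a) (Fpoly k) = 1 \<and> order a (Fpoly k) = 1" for k and a :: real
  define a where "a k = (SOME x. Q k x)" for k
  have ex: "\<exists>x. Q k x" if "odd k" for k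
  proof (rule Fpoly_odd_zero_set[OF that])
    fix x assume "0 < x" "x < 1" "{t \<in> {-1..1}. poly (Fpoly k) t = 0} = {-x, x}"
      "order (-x) (Fpoly k) = 1" "order x (Fpoly k) = 1"
    then have "Q k x" unfolding Q_def by (intro conjI)
    then show ?thesis ..
  qed
  have Qa: "Q k (a k)" if "odd k" for k
    unfolding a_def using ex[OF that] by (rule someI_ex)
  have a: "0 < a k" "a k < 1" "{t \<in> {-1..1}. poly (Fpoly k) t = 0} = {-a k, a k}"
      "order (-a k) (Fpoly k) = 1" "order (a k) (Fpoly k) = 1" if "odd k" for k
    using Qa[OF that, unfolded Q_def] by simp_all
  define F where "F = inf sequentially (principal {k :: nat. odd k})"
  have odd: "eventually P F" if "\<And>k. odd k \<Longrightarrow> P k" for P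
    unfolding F_def eventually_inf_principal using that by (auto intro: always_eventually)
  define y where "y k = pi * (a k - 1 / 2)" for k
  have zero: "a k \<in> {0..1}" "poly (Fpoly k) (a k) = 0" if "odd k" for k
  proof -
    show "a k \<in> {0..1}" using a(1,2)[OF that] by simp
    have "a k \<in> {t \<in> {-1..1}. poly (Fpoly k) t = 0}" unfolding a(3)[OF that] by simp
    then show "poly (Fpoly k) (a k) = 0" by simp
  qed
  obtain K where K: "\<forall>k x. odd k \<longrightarrow> x \<in> {0..1} \<longrightarrow> poly (Fpoly k) x = 0 \<longrightarrow>
      \<bar>\<Sum>m<2. (-1) ^ m * cos (pi * real m * x) / real m ^ (k + 1)\<bar> \<le> K / real 2 ^ (k + 1)"
    using Fpoly_zero_truncated_series[of 2] by auto
  have y: "y \<in> O[F](\<lambda>k. 1 / 2 ^ Suc k)"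
  proof (intro bigoI[where c = "2 * K"] odd)
    fix k :: nat assume k: "odd k"
    have "\<bar>a k - 1 / 2\<bar> \<le> 1 / 2" unfolding abs_le_iff using a(1,2)[OF k] by linarith
    then have "\<bar>y k\<bar> \<le> pi / 2"
      unfolding y_def using mult_left_mono[of "\<bar>a k - 1 / 2\<bar>" "1 / 2" pi] by (simp add: abs_mult)
    then have "\<bar>y k\<bar> \<le> 2 * \<bar>sin (y k)\<bar>" by (rule abs_le_2_abs_sin)
    also have "sin (y k) = - cos (pi * a k)"
      unfolding y_def right_diff_distrib by (simp add: sin_diff)
    also have "\<bar>- cos (pi * a k)\<bar> \<le> K / 2 ^ Suc k"
      using K[rule_format, OF k zero[OF k]] by (simp add: numeral_2_eq_2)
    finally show "norm (y k) \<le> 2 * K * norm (1 / 2 ^ Suc k :: real)" by simp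
  qed
  obtain L where L: "\<forall>k x. odd k \<longrightarrow> x \<in> {0..1} \<longrightarrow> poly (Fpoly k) x = 0 \<longrightarrow>
      \<bar>\<Sum>m<10. (-1) ^ m * cos (pi * real m * x) / real m ^ (k + 1)\<bar> \<le> L / real 10 ^ (k + 1)"
    using Fpoly_zero_truncated_series[of 10] by auto
  have "(\<lambda>k. y k - (1 / 2 ^ Suc k - 1 / 4 ^ Suc k + 4 / 6 ^ Suc k - 17 / 6 / 8 ^ Suc k))
    \<in> O[F](\<lambda>k. 1 / 10 ^ Suc k)"
  proof (rule sine_equation_expansion[OF y], intro bigoI[where c = L] odd)
    fix k :: nat assume k: "odd k"
    show "norm (sin (y k) - cos (2 * y k) / 2 ^ Suc k - sin (3 * y k) / 3 ^ Suc k
      + cos (4 * y k) / 4 ^ Suc k + sin (5 * y k) / 5 ^ Suc k - cos (6 * y k) / 6 ^ Suc k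
      - sin (7 * y k) / 7 ^ Suc k + cos (8 * y k) / 8 ^ Suc k + sin (9 * y k) / 9 ^ Suc k)
      \<le> L * norm (1 / 10 ^ Suc k :: real)"
      using L[rule_format, OF k zero[OF k]] unfolding cosine_terms_at_half[OF y_def, symmetric] by simp
  qed
  then have "(\<lambda>k. 1 / pi * (y k - (1 / 2 ^ Suc k - 1 / 4 ^ Suc k + 4 / 6 ^ Suc k - 17 / 6 / 8 ^ Suc k)))
    \<in> O[F](\<lambda>k. 1 / 10 ^ Suc k)"
    by (intro landau_o.big.cmult_in_iff[THEN iffD2] disjI2) auto
  also have "(\<lambda>k. 1 / pi * (y k - (1 / 2 ^ Suc k - 1 / 4 ^ Suc k + 4 / 6 ^ Suc k - 17 / 6 / 8 ^ Suc k))) =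
    (\<lambda>k. a k - 1 / 2 -
                 (1 / (pi * 2 ^ (k + 1)) - 1 / (pi * 4 ^ (k + 1))
                  + 4 / (pi * 6 ^ (k + 1)) - 17 / (6 * pi * 8 ^ (k + 1))))"
    by (rule ext) (simp add: y_def right_diff_distrib distrib_left del: power_Suc)
  finally have expansion: "(\<lambda>k. a k - 1 / 2 -
                 (1 / (pi * 2 ^ (k + 1)) - 1 / (pi * 4 ^ (k + 1))
                  + 4 / (pi * 6 ^ (k + 1)) - 17 / (6 * pi * 8 ^ (k + 1))))
              \<in> O[F](\<lambda>k. 1 / 10 ^ (k + 1))" by simp
  have "(y \<longlongrightarrow> 0) F"
  proof -
    obtain c where c: "eventually (\<lambda>k. norm (y k) \<le> c * norm (1 / 2 ^ Suc k :: real)) F"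
      using y by (elim landau_o.bigE)
    have "(\<lambda>k. (1 / 2 :: real) ^ Suc k) \<longlonglongrightarrow> 0"
      by (intro LIMSEQ_Suc LIMSEQ_realpow_zero) auto
    from tendsto_mult_right_zero[OF this, of c]
    have "(\<lambda>k. c * norm (1 / 2 ^ Suc k :: real)) \<longlonglongrightarrow> 0"
      by (simp add: power_one_over del: power_Suc)
    then have "((\<lambda>k. c * norm (1 / 2 ^ Suc k :: real)) \<longlongrightarrow> 0) F"
      by (rule tendsto_mono[rotated]) (simp add: F_def)
    then show ?thesis by (rule Lim_null_comparison[OF c])
  qed
  then have "((\<lambda>k. 1 / 2 + y k / pi) \<longlongrightarrow> 1 / 2 + 0 / pi) F"
    by (intro tendsto_intros) auto
  then have limit: "(a \<longlongrightarrow> 1 / 2) F"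
    by (simp add: y_def)
  show "\<exists>a :: nat \<Rightarrow> real.
            (\<forall>k\<ge>2. odd k \<longrightarrow>
               a k \<in> {0<..<1} \<and>
               {t \<in> {-1..1}. poly (Fpoly k) t = 0} = {- a k, a k} \<and>
               order (- a k) (Fpoly k) = 1 \<and> order (a k) (Fpoly k) = 1) \<and>
            (a \<longlongrightarrow> 1 / 2) (inf sequentially (principal {k. odd k})) \<and>
            (\<lambda>k. a k - 1 / 2 -
                 (1 / (pi * 2 ^ (k + 1)) - 1 / (pi * 4 ^ (k + 1))
                  + 4 / (pi * 6 ^ (k + 1)) - 17 / (6 * pi * 8 ^ (k + 1))))
              \<in> O[inf sequentially (principal {k. odd k})](\<lambda>k. 1 / 10 ^ (k + 1))"
  proof (intro exI conjI allI impI)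
    fix k :: nat assume k: "odd k"
    show "a k \<in> {0<..<1}" using a(1,2)[OF k] by simp
    show "{t \<in> {-1..1}. poly (Fpoly k) t = 0} = {-a k, a k}" by (rule a(3)[OF k])
    show "order (-a k) (Fpoly k) = 1" by (rule a(4)[OF k])
    show "order (a k) (Fpoly k) = 1" by (rule a(5)[OF k])
  qed (fact limit[unfolded F_def] expansion[unfolded F_def])+
qed

end
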